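(* Let $Sol^3$ denote $\mathbb{R}^3$ with coordinates $(x,y,t)$ endowed with the Riemannian metric $g = e^{2t}dx^2+e^{-2t}dy^2+dt^2$. Then $Sol^3$ carries no (gradient) quasi-Einstein structure: there do not exist a smooth function $f:\mathbb{R}^3\to\mathbb{R}$ and constants $0<m\le\infty$ and $\lambda\in\mathbb{R}$ such that $$Ric+\nabla^2 f-\frac1m\,df\otimes df=\lambda g .$$
   Context: $Ric$ is the Ricci tensor of $g$ and $\nabla^2 f$ is the Hessian of $f$ with respect to $g$. For $m=\infty$ the convention is $\frac1m=0$. A (gradient) $m$-quasi-Einstein structure on a Riemannian manifold $(M,g)$ consists of a smooth function $f$ on $M$ and a constant $\lambda$ with $Ric+\nabla^2 f-\frac1m df\otimes df=\lambda g$ on $M$; constant $f$ is allowed. *)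

theory Defs
  imports "HOL-Analysis.Analysis"
begin

definition partial :: "'n::finite \<Rightarrow> (real^'n \<Rightarrow> real) \<Rightarrow> real^'n \<Rightarrow> real" where
  "partial i f p = frechet_derivative f (at p) (axis i 1)"

primrec Ck :: "nat \<Rightarrow> (real^'n::finite \<Rightarrow> real) \<Rightarrow> bool" where
  "Ck 0 f = continuous_on UNIV f"
| "Ck (Suc k) f = (f differentiable_on UNIV \<and> (\<forall>i. Ck k (partial i f)))"

definition smooth :: "(real^'n::finite \<Rightarrow> real) \<Rightarrow> bool" where
  "smooth f \<longleftrightarrow> (\<forall>k. Ck k f)"

text \<open>
  A Riemannian metric on \<open>\<real>\<^sup>n\<close> is given by its matrix of components in the standard coordinates:
  \<open>g p $ i $ j = g(\<partial>\<^sub>i, \<partial>\<^sub>j)\<close> at the point \<open>p\<close>.  All tensors below are given by their components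
  in these coordinates.
\<close>

type_synonym 'n metric = "real^'n \<Rightarrow> real^'n^'n"

text \<open>Levi-Civita connection: \<open>\<nabla>\<^bsub>\<partial>i\<^esub> \<partial>\<^sub>j = (\<Sum>k. christoffel g k i j \<partial>\<^sub>k)\<close>.\<close>

definition christoffel :: "'n::finite metric \<Rightarrow> 'n \<Rightarrow> 'n \<Rightarrow> 'n \<Rightarrow> real^'n \<Rightarrow> real" where
  "christoffel g k i j p = (\<Sum>l\<in>UNIV. matrix_inv (g p) $ k $ l *
     (partial i (\<lambda>q. g q $ j $ l) p + partial j (\<lambda>q. g q $ i $ l) p
       - partial l (\<lambda>q. g q $ i $ j) p)) / 2"

text \<open>
  Curvature with the convention
  \<open>R(X,Y)Z = \<nabla>\<^sub>X \<nabla>\<^sub>Y Z - \<nabla>\<^sub>Y \<nabla>\<^sub>X Z - \<nabla>\<^bsub>[X,Y]\<^esub> Z\<close> and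
  \<open>R(\<partial>\<^sub>i, \<partial>\<^sub>j) \<partial>\<^sub>k = (\<Sum>l. riemann g l i j k \<partial>\<^sub>l)\<close>.  The Ricci tensor \<open>Ric(Y,Z)\<close> is the trace of
  \<open>X \<mapsto> R(X,Y)Z\<close>, so it is positive on round spheres.
\<close>

definition riemann :: "'n::finite metric \<Rightarrow> 'n \<Rightarrow> 'n \<Rightarrow> 'n \<Rightarrow> 'n \<Rightarrow> real^'n \<Rightarrow> real" where
  "riemann g l i j k p =
     partial i (christoffel g l j k) p - partial j (christoffel g l i k) p
     + (\<Sum>s\<in>UNIV. christoffel g l i s p * christoffel g s j k p
                 - christoffel g l j s p * christoffel g s i k p)"

definition Ric :: "'n::finite metric \<Rightarrow> real^'n \<Rightarrow> real^'n^'n" where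
  "Ric g p = (\<chi> j k. \<Sum>i\<in>UNIV. riemann g i i j k p)"

text \<open>\<open>(\<nabla>\<^sup>2 f)(X,Y) = X(Y f) - (\<nabla>\<^sub>X Y) f\<close>.\<close>

definition Hess :: "'n::finite metric \<Rightarrow> (real^'n \<Rightarrow> real) \<Rightarrow> real^'n \<Rightarrow> real^'n^'n" where
  "Hess g f p = (\<chi> i j. partial i (partial j f) p
     - (\<Sum>k\<in>UNIV. christoffel g k i j p * partial k f p))"

definition df_tensor_df :: "(real^'n::finite \<Rightarrow> real) \<Rightarrow> real^'n \<Rightarrow> real^'n^'n" where
  "df_tensor_df f p = (\<chi> i j. partial i f p * partial j f p)"

text \<open>The parameter \<open>m\<close> is meant to satisfy \<open>0 < m \<le> \<infinity>\<close>; in \<^typ>\<open>ereal\<close>, \<open>1 / \<infinity> = 0\<close>.\<close>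

definition quasi_einstein ::
  "'n::finite metric \<Rightarrow> ereal \<Rightarrow> (real^'n \<Rightarrow> real) \<Rightarrow> real \<Rightarrow> bool" where
  "quasi_einstein g m f c \<longleftrightarrow> smooth f \<and>
     (\<forall>p. Ric g p + Hess g f p - real_of_ereal (1 / m) *\<^sub>R df_tensor_df f p = c *\<^sub>R g p)"

text \<open>The coordinates \<open>(x, y, t)\<close> of \<open>p\<close> are \<open>(p $ 1, p $ 2, p $ 3)\<close>.\<close>

definition sol3_metric :: "3 metric" where
  "sol3_metric p = vector [vector [exp (2 * p $ 3), 0, 0],
                           vector [0, exp (- 2 * p $ 3), 0],
                           vector [0, 0, 1]]"

end

theory Submission
  imports Defs
begin

text \<open>
  Put \<open>a = 1/m\<close> and \<open>s = f\<^sub>t\<close>.  The equation prescribes \<open>f\<^sub>x\<^sub>x\<close>, \<open>f\<^sub>x\<^sub>t\<close> and \<open>f\<^sub>t\<^sub>t\<close> in terms of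
  the first derivatives, and comparing \<open>f\<^sub>x\<^sub>x\<^sub>t\<close> with \<open>f\<^sub>x\<^sub>t\<^sub>x\<close> all terms containing \<open>f\<^sub>x\<close> cancel, which
  leaves \<open>s (a \<lambda> + 1) = -2\<close>.  The same computation in the \<open>y\<close> direction gives \<open>s (a \<lambda> + 1) = 2\<close>.
\<close>

section \<open>Partial derivatives along coordinate lines and their commutation\<close>

lemma has_real_derivative_partial:
  assumes "f differentiable (at (p + s *\<^sub>R axis i 1))"
  shows "((\<lambda>h. f (p + h *\<^sub>R axis i 1)) has_real_derivative
           partial i f (p + s *\<^sub>R axis i 1)) (at s)"
proof -
  let ?F = "frechet_derivative f (at (p + s *\<^sub>R axis i 1))"
  have F: "(f has_derivative ?F) (at (p + s *\<^sub>R axis i 1))"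
    using assms frechet_derivative_works by blast
  have "((\<lambda>h. p + h *\<^sub>R axis i 1) has_derivative (\<lambda>h. h *\<^sub>R axis i 1)) (at s)"
    by (auto intro!: derivative_eq_intros)
  from has_derivative_compose[OF this F]
  have "((\<lambda>h. f (p + h *\<^sub>R axis i 1)) has_derivative (\<lambda>h. ?F (h *\<^sub>R axis i 1))) (at s)" .
  moreover have "?F (h *\<^sub>R axis i 1) = partial i f (p + s *\<^sub>R axis i 1) * h" for h
    using linear_frechet_derivative[OF assms] by (simp add: partial_def linear_scale)
  ultimately show ?thesis
    by (simp add: has_field_derivative_def)
qed

lemma has_real_derivative_partial_0:
  assumes "f differentiable (at p)"
  shows "((\<lambda>h. f (p + h *\<^sub>R axis i 1)) has_real_derivative partial i f p) (at 0)"
  using has_real_derivative_partial[of f p 0 i] assms by simp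

text \<open>Lets a partial derivative be computed with the one-variable rules along a coordinate
  line, once differentiability of the function is known.\<close>

lemma partial_eqI:
  assumes "f differentiable (at p)"
    and "((\<lambda>h. f (p + h *\<^sub>R axis i 1)) has_real_derivative D) (at 0)"
  shows "partial i f p = D"
  using has_real_derivative_partial_0[OF assms(1)] assms(2) by (rule DERIV_unique)

lemma partial_const [simp]: "partial i (\<lambda>_. c) p = 0"
  by (simp add: partial_def)

lemma partial_comp_coord:
  assumes "(\<phi> has_real_derivative D) (at (p $ k))"
  shows "partial i (\<lambda>q. \<phi> (q $ k)) p = (if i = k then D else 0)"
proof -
  have "((\<lambda>q. q $ k) has_derivative (\<lambda>h. h $ k)) (at p)"
    by (rule bounded_linear_imp_has_derivative) (rule bounded_linear_vec_nth)
  from has_derivative_compose[OF this assms[unfolded has_field_derivative_def]]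
  have "((\<lambda>q. \<phi> (q $ k)) has_derivative (\<lambda>h. D * h $ k)) (at p)" .
  from frechet_derivative_at[OF this, symmetric] show ?thesis
    by (simp add: partial_def axis_def)
qed

lemma Ck_SucD:
  assumes "Ck (Suc k) f"
  shows "f differentiable (at p)" "Ck k (partial i f)"
  using assms by (auto simp: differentiable_on_def)

text \<open>The mean value theorem is applied twice: in direction \<open>i\<close> to the difference
  of \<open>f\<close> along two opposite edges of a square of side \<open>h\<close>, then in
  direction \<open>j\<close> to \<open>partial i f\<close>.\<close>

lemma second_difference_mvt:
  assumes f: "\<And>q. f differentiable (at q)"
    and fi: "\<And>q. partial i f differentiable (at q)"
    and h: "0 < h"
  obtains s r where "0 < s" "s < h" "0 < r" "r < h"
    "f (p + h *\<^sub>R axis i 1 + h *\<^sub>R axis j 1) - f (p + h *\<^sub>R axis i 1)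
       - f (p + h *\<^sub>R axis j 1) + f p
     = h * h * partial j (partial i f) (p + s *\<^sub>R axis i 1 + r *\<^sub>R axis j 1)"
proof -
  let ?i = "axis i 1" and ?j = "axis j 1"
  let ?\<phi> = "\<lambda>s. f ((p + h *\<^sub>R ?j) + s *\<^sub>R ?i) - f (p + s *\<^sub>R ?i)"
  have "(?\<phi> has_real_derivative
      partial i f ((p + h *\<^sub>R ?j) + s *\<^sub>R ?i) - partial i f (p + s *\<^sub>R ?i)) (at s)" for s
    by (intro DERIV_diff has_real_derivative_partial f)
  from MVT2[OF h this] obtain s where s: "0 < s" "s < h"
    and 1: "?\<phi> h - ?\<phi> 0 = h * (partial i f ((p + h *\<^sub>R ?j) + s *\<^sub>R ?i) - partial i f (p + s *\<^sub>R ?i))"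
    by auto
  have "((\<lambda>r. partial i f ((p + s *\<^sub>R ?i) + r *\<^sub>R ?j)) has_real_derivative
      partial j (partial i f) ((p + s *\<^sub>R ?i) + r *\<^sub>R ?j)) (at r)" for r
    by (intro has_real_derivative_partial fi)
  from MVT2[OF h this] obtain r where r: "0 < r" "r < h"
    and 2: "partial i f ((p + s *\<^sub>R ?i) + h *\<^sub>R ?j) - partial i f (p + s *\<^sub>R ?i)
       = h * partial j (partial i f) ((p + s *\<^sub>R ?i) + r *\<^sub>R ?j)"
    by auto
  have "(p + h *\<^sub>R ?j) + s *\<^sub>R ?i = (p + s *\<^sub>R ?i) + h *\<^sub>R ?j"
    "(p + h *\<^sub>R ?j) + h *\<^sub>R ?i = (p + h *\<^sub>R ?i) + h *\<^sub>R ?j"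
    by (simp_all add: algebra_simps)
  with 1 2 show ?thesis
    by (intro that[OF s r]) (simp add: algebra_simps)
qed

text \<open>The second difference over a square is symmetric in \<open>i\<close> and
  \<open>j\<close>, so the two mixed derivatives take a common value at two points of the square.
  For a small square, continuity then excludes different values at \<open>p\<close>.\<close>

lemma partial_commute:
  assumes "Ck (Suc (Suc 0)) f"
  shows "partial i (partial j f) p = partial j (partial i f) p"
proof (rule ccontr)
  let ?A = "partial i (partial j f)" and ?B = "partial j (partial i f)"
  assume ne: "?A p \<noteq> ?B p"
  \<comment> \<open>Half the gap: numbers less than \<open>e\<close> away from \<open>?A p\<close>
    and from \<open>?B p\<close> respectively cannot coincide.\<close>
  define e where "e = \<bar>?A p - ?B p\<bar> / 2"
  have "e > 0" using ne by (simp add: e_def)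
  have f: "f differentiable (at q)" "partial k f differentiable (at q)" for q k
    using Ck_SucD(1)[OF assms] Ck_SucD(1)[OF Ck_SucD(2)[OF assms]] by blast+
  have cont: "isCont (partial k (partial l f)) p" for k l
    using Ck_SucD(2)[OF Ck_SucD(2)[OF assms]] by (simp add: continuous_on_eq_continuous_at)
  from cont \<open>e > 0\<close> obtain d1 where d1: "d1 > 0" "\<And>q. dist q p < d1 \<Longrightarrow> dist (?A q) (?A p) < e"
    unfolding continuous_at_eps_delta by blast
  from cont \<open>e > 0\<close> obtain d2 where d2: "d2 > 0" "\<And>q. dist q p < d2 \<Longrightarrow> dist (?B q) (?B p) < e"
    unfolding continuous_at_eps_delta by blast
  \<comment> \<open>Two displacements shorter than \<open>h\<close> add up to less than both
    \<open>d1\<close> and \<open>d2\<close>.\<close>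
  define h where "h = min d1 d2 / 2"
  have h: "h > 0" using d1(1) d2(1) by (simp add: h_def)
  have near: "dist (p + s *\<^sub>R axis k 1 + r *\<^sub>R axis l 1) p < min d1 d2"
    if "0 < s" "s < h" "0 < r" "r < h" for s r k l
  proof -
    have "dist (p + s *\<^sub>R axis k 1 + r *\<^sub>R axis l 1) p = norm (s *\<^sub>R axis k 1 + r *\<^sub>R axis l (1::real))"
      by (simp add: dist_norm algebra_simps)
    also have "\<dots> \<le> \<bar>s\<bar> + \<bar>r\<bar>"
      by (rule norm_triangle_le) simp
    finally show ?thesis using that by (simp add: h_def)
  qed
  obtain s r where B: "0 < s" "s < h" "0 < r" "r < h"
    "f (p + h *\<^sub>R axis i 1 + h *\<^sub>R axis j 1) - f (p + h *\<^sub>R axis i 1)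
       - f (p + h *\<^sub>R axis j 1) + f p = h * h * ?B (p + s *\<^sub>R axis i 1 + r *\<^sub>R axis j 1)"
    using second_difference_mvt[OF f h] by metis
  obtain s' r' where A: "0 < s'" "s' < h" "0 < r'" "r' < h"
    "f (p + h *\<^sub>R axis j 1 + h *\<^sub>R axis i 1) - f (p + h *\<^sub>R axis j 1)
       - f (p + h *\<^sub>R axis i 1) + f p = h * h * ?A (p + s' *\<^sub>R axis j 1 + r' *\<^sub>R axis i 1)"
    using second_difference_mvt[OF f h] by metis
  have swap: "p + h *\<^sub>R axis j 1 + h *\<^sub>R axis i 1 = p + h *\<^sub>R axis i 1 + h *\<^sub>R axis j 1"
    by (simp add: algebra_simps)
  have "h * h * ?A (p + s' *\<^sub>R axis j 1 + r' *\<^sub>R axis i 1)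
      = h * h * ?B (p + s *\<^sub>R axis i 1 + r *\<^sub>R axis j 1)"
    using A(5)[unfolded swap] B(5) by linarith
  with h have eq: "?A (p + s' *\<^sub>R axis j 1 + r' *\<^sub>R axis i 1) = ?B (p + s *\<^sub>R axis i 1 + r *\<^sub>R axis j 1)"
    by simp
  have "dist (?A (p + s' *\<^sub>R axis j 1 + r' *\<^sub>R axis i 1)) (?A p) < e"
    "dist (?B (p + s *\<^sub>R axis i 1 + r *\<^sub>R axis j 1)) (?B p) < e"
    using near[OF A(1-4)] near[OF B(1-4)] d1(2) d2(2) by simp_all
  with eq show False by (simp add: e_def dist_real_def abs_if split: if_splits)
qed

section \<open>Metric, connection and curvature of Sol^3\<close>

lemma sol3_metric_nth:
  "sol3_metric p $ i $ j =
     (if i = j then if i = 1 then exp (2 * p $ 3) else if i = 2 then exp (- 2 * p $ 3) else 1 else 0)"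
  using exhaust_3[of i] exhaust_3[of j] by (auto simp: sol3_metric_def)

lemma matrix_inv_sol3_metric_nth:
  "matrix_inv (sol3_metric p) $ i $ j =
     (if i = j then if i = 1 then exp (- 2 * p $ 3) else if i = 2 then exp (2 * p $ 3) else 1 else 0)"
proof -
  define B :: "real^3^3" where "B = (\<chi> i j.
     if i = j then if i = 1 then exp (- 2 * p $ 3) else if i = 2 then exp (2 * p $ 3) else 1 else 0)"
  have "sol3_metric p ** B = mat 1" "B ** sol3_metric p = mat 1"
    by (auto simp: vec_eq_iff forall_3 matrix_matrix_mult_def sum_3 B_def mat_def sol3_metric_nth
        simp flip: exp_add)
  \<comment> \<open>\<open>matrix_inv\<close> is a choice among two-sided inverses; \<open>B\<close>
    witnesses that there is one, and associativity then forces the choice to be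
    \<open>B\<close>.\<close>
  moreover from this have "matrix_inv (sol3_metric p) ** sol3_metric p = mat 1"
    unfolding matrix_inv_def by (metis (mono_tags, lifting) someI)
  ultimately have "matrix_inv (sol3_metric p) = B"
    by (metis matrix_mul_assoc matrix_mul_lid matrix_mul_rid)
  then show ?thesis by (simp add: B_def)
qed

lemma partial_sol3_metric:
  "partial k (\<lambda>q. sol3_metric q $ i $ j) p =
     (if i = j \<and> k = 3 then if i = 1 then 2 * exp (2 * p $ 3)
        else if i = 2 then - 2 * exp (- 2 * p $ 3) else 0 else 0)"
proof -
  have "partial k (\<lambda>q::real^3. exp (2 * q $ 3)) p = (if k = 3 then 2 * exp (2 * p $ 3) else 0)"
    by (rule partial_comp_coord[where \<phi> = "\<lambda>t. exp (2 * t)"]) (auto intro!: derivative_eq_intros)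
  moreover have "partial k (\<lambda>q::real^3. exp (- 2 * q $ 3)) p = (if k = 3 then - 2 * exp (- 2 * p $ 3) else 0)"
    by (rule partial_comp_coord[where \<phi> = "\<lambda>t. exp (- 2 * t)"]) (auto intro!: derivative_eq_intros)
  ultimately show ?thesis
    using exhaust_3[of i] exhaust_3[of j] by (auto simp: sol3_metric_nth)
qed

text \<open>Stated as equations between functions, so that they also rewrite under
  \<open>partial\<close> in \<open>riemann\<close>.\<close>

lemma christoffel_sol3:
  "christoffel sol3_metric 1 i j = (\<lambda>p. if i = 1 \<and> j = 3 \<or> i = 3 \<and> j = 1 then 1 else 0)"
  "christoffel sol3_metric 2 i j = (\<lambda>p. if i = 2 \<and> j = 3 \<or> i = 3 \<and> j = 2 then - 1 else 0)"
  "christoffel sol3_metric 3 i j = (\<lambda>p. if i = 1 \<and> j = 1 then - exp (2 * p $ 3)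
     else if i = 2 \<and> j = 2 then exp (- 2 * p $ 3) else 0)"
  using exhaust_3[of i] exhaust_3[of j]
  by (elim disjE; simp add: fun_eq_iff christoffel_def sum_3 partial_sol3_metric
      matrix_inv_sol3_metric_nth exp_minus)+

text \<open>In the xx and yy components the t-derivative of the Christoffel symbol with upper index
  3 cancels against the quadratic terms; in the tt component the quadratic terms give -1 -
  1.\<close>

lemma Ric_sol3: "Ric sol3_metric p $ i $ j = (if i = 3 \<and> j = 3 then - 2 else 0)"
proof -
  have "partial k (\<lambda>q::real^3. - exp (2 * q $ 3)) p = (if k = 3 then - 2 * exp (2 * p $ 3) else 0)" for k
    by (rule partial_comp_coord[where \<phi> = "\<lambda>t. - exp (2 * t)"]) (auto intro!: derivative_eq_intros)
  moreover have "partial k (\<lambda>q::real^3. exp (- 2 * q $ 3)) p = (if k = 3 then - 2 * exp (- 2 * p $ 3) else 0)" for k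
    by (rule partial_comp_coord[where \<phi> = "\<lambda>t. exp (- 2 * t)"]) (auto intro!: derivative_eq_intros)
  ultimately show ?thesis
    using exhaust_3[of i] exhaust_3[of j]
    by (auto simp: Ric_def riemann_def sum_3 christoffel_sol3)
qed

lemma Hess_sol3:
  "Hess sol3_metric f p $ 1 $ 1 = partial 1 (partial 1 f) p + exp (2 * p $ 3) * partial 3 f p"
  "Hess sol3_metric f p $ 2 $ 2 = partial 2 (partial 2 f) p - exp (- 2 * p $ 3) * partial 3 f p"
  "Hess sol3_metric f p $ 3 $ 3 = partial 3 (partial 3 f) p"
  "Hess sol3_metric f p $ 3 $ 1 = partial 3 (partial 1 f) p - partial 1 f p"
  "Hess sol3_metric f p $ 1 $ 3 = partial 1 (partial 3 f) p - partial 1 f p"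
  "Hess sol3_metric f p $ 3 $ 2 = partial 3 (partial 2 f) p + partial 2 f p"
  "Hess sol3_metric f p $ 2 $ 3 = partial 2 (partial 3 f) p + partial 2 f p"
  by (simp_all add: Hess_def sum_3 christoffel_sol3)

section \<open>The integrability condition and the contradiction\<close>

text \<open>
  The hypotheses are the components \<open>ii\<close>, \<open>ti\<close>, \<open>it\<close> and \<open>tt\<close> of the quasi-Einstein equation, where
  \<open>\<epsilon> = 1\<close> for the coordinate \<open>x\<close> and \<open>\<epsilon> = -1\<close> for \<open>y\<close>.  The two cases are exchanged by the
  isometry \<open>(x, y, t) \<mapsto> (y, x, -t)\<close>.
\<close>

lemma sol3_integrability:
  fixes f :: "real^3 \<Rightarrow> real"
  assumes f: "smooth f"
    and \<epsilon>: "\<epsilon> = 1 \<or> \<epsilon> = -1" and i: "i \<noteq> 3"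
    and ii: "\<And>p. partial i (partial i f) p =
        exp (2 * \<epsilon> * p $ 3) * (c - \<epsilon> * partial 3 f p) + a * (partial i f p)\<^sup>2"
    and ti: "\<And>p. partial 3 (partial i f) p = \<epsilon> * partial i f p + a * partial i f p * partial 3 f p"
    and it: "\<And>p. partial i (partial 3 f) p = \<epsilon> * partial i f p + a * partial i f p * partial 3 f p"
    and tt: "\<And>p. partial 3 (partial 3 f) p = c + 2 + a * (partial 3 f p)\<^sup>2"
  shows "partial 3 f p * (a * c + 1) = - 2 * \<epsilon>"
proof -
  have Ck: "Ck k f" for k
    using f by (simp add: smooth_def)
  have d1: "partial k f differentiable (at p)" for k
    by (rule Ck_SucD(1)[OF Ck_SucD(2)[OF Ck]])
  have d2: "partial k (partial l f) differentiable (at p)" for k l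
    by (rule Ck_SucD(1)[OF Ck_SucD(2)[OF Ck_SucD(2)[OF Ck]]])
  have d3: "((\<lambda>h. (p + h *\<^sub>R axis k 1) $ 3) has_real_derivative axis k 1 $ 3) (at 0)" for k
    by (auto intro!: derivative_eq_intros)
  note D = has_real_derivative_partial_0[OF d1] d3
  define u s E where "u = partial i f p" and "s = partial 3 f p" and "E = exp (2 * \<epsilon> * p $ 3)"
  \<comment> \<open>\<open>ui\<close>, \<open>ut\<close> and \<open>st\<close> are the values that
    the equation prescribes at \<open>p\<close> for the second derivatives ii, ti and tt.\<close>
  define ui where "ui = E * (c - \<epsilon> * s) + a * u\<^sup>2"
  define ut where "ut = \<epsilon> * u + a * u * s"
  define st where "st = c + 2 + a * s\<^sup>2"
  have "partial 3 (partial i (partial i f)) p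
      = 2 * \<epsilon> * E * (c - \<epsilon> * s) - E * \<epsilon> * st + 2 * a * u * ut"
    \<comment> \<open>The second derivative is first replaced by its prescribed expression along the
      whole line; differentiating that creates new second derivatives, which \<open>ti\<close> and
      \<open>tt\<close> eliminate again.\<close>
    by (rule partial_eqI[OF d2], unfold ii,
        (rule derivative_eq_intros D refl)+)
      (simp add: u_def s_def E_def ut_def st_def ti tt axis_def algebra_simps power2_eq_square)
  moreover have "partial i (partial 3 (partial i f)) p = \<epsilon> * ui + a * ui * s + a * u * ut"
    by (rule partial_eqI[OF d2], unfold ti,
        (rule derivative_eq_intros D refl)+)
      (simp add: u_def s_def E_def ui_def ut_def ii it algebra_simps power2_eq_square)
  moreover have "partial 3 (partial i (partial i f)) p = partial i (partial 3 (partial i f)) p"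
    by (rule partial_commute[OF Ck_SucD(2)[OF Ck]])
  \<comment> \<open>The \<open>u\<close> terms agree on both sides:
    \<open>a * u * (\<epsilon> * u + a * u * s)\<close> is \<open>a * u * ut\<close>.\<close>
  ultimately have "E * (2 * \<epsilon> * (c - \<epsilon> * s) - \<epsilon> * st) = E * ((\<epsilon> + a * s) * (c - \<epsilon> * s))"
    by (simp add: ui_def ut_def algebra_simps power2_eq_square)
  moreover have "E \<noteq> 0" by (simp add: E_def)
  ultimately have "2 * \<epsilon> * (c - \<epsilon> * s) - \<epsilon> * st = (\<epsilon> + a * s) * (c - \<epsilon> * s)"
    by simp
  \<comment> \<open>Here \<open>\<epsilon> * \<epsilon> = 1\<close> removes the terms in
    \<open>a * s * s\<close>.\<close>
  then have "s * (a * c + 1) = - 2 * \<epsilon>"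
    using \<epsilon> by (auto simp: st_def algebra_simps power2_eq_square)
  then show ?thesis by (simp add: s_def)
qed

theorem theorem1:
  "\<not> (\<exists>(f :: real^3 \<Rightarrow> real) (m :: ereal) (c :: real).
        0 < m \<and> m \<le> \<infinity> \<and> quasi_einstein sol3_metric m f c)"
proof
  assume "\<exists>(f :: real^3 \<Rightarrow> real) (m :: ereal) (c :: real).
        0 < m \<and> m \<le> \<infinity> \<and> quasi_einstein sol3_metric m f c"
  then obtain f :: "real^3 \<Rightarrow> real" and m c where q: "quasi_einstein sol3_metric m f c"
    by blast
  \<comment> \<open>For infinite \<open>m\<close> this is 0, so finite and infinite \<open>m\<close>
    are treated together.\<close>
  define a where "a = real_of_ereal (1 / m)"
  have f: "smooth f" using q by (simp add: quasi_einstein_def)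
  have eq: "Ric sol3_metric p $ i $ j + Hess sol3_metric f p $ i $ j
      - a * (partial i f p * partial j f p) = c * sol3_metric p $ i $ j" for p i j
  proof -
    have "Ric sol3_metric p + Hess sol3_metric f p - a *\<^sub>R df_tensor_df f p = c *\<^sub>R sol3_metric p"
      using q by (simp add: quasi_einstein_def a_def)
    then have "(Ric sol3_metric p + Hess sol3_metric f p - a *\<^sub>R df_tensor_df f p) $ i $ j
        = (c *\<^sub>R sol3_metric p) $ i $ j"
      by simp
    then show ?thesis by (simp add: df_tensor_df_def)
  qed
  note eqs = Ric_sol3 Hess_sol3 sol3_metric_nth
  have tt: "partial 3 (partial 3 f) p = c + 2 + a * (partial 3 f p)\<^sup>2" for p
    using eq[of p 3 3] by (simp add: eqs power2_eq_square)
  \<comment> \<open>The origin is an arbitrary choice of point; the x and y directions give the same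
    number the values -2 and 2.\<close>
  have "partial 3 f 0 * (a * c + 1) = - 2 * 1"
  proof (rule sol3_integrability[OF f _ _ _ _ _ tt, of _ 1])
    fix p
    show "partial 1 (partial 1 f) p
        = exp (2 * 1 * p $ 3) * (c - 1 * partial 3 f p) + a * (partial 1 f p)\<^sup>2"
      using eq[of p 1 1] by (simp add: eqs power2_eq_square algebra_simps)
    show "partial 3 (partial 1 f) p = 1 * partial 1 f p + a * partial 1 f p * partial 3 f p"
      using eq[of p 3 1] by (simp add: eqs algebra_simps)
    show "partial 1 (partial 3 f) p = 1 * partial 1 f p + a * partial 1 f p * partial 3 f p"
      using eq[of p 1 3] by (simp add: eqs algebra_simps)
  qed simp_all
  moreover have "partial 3 f 0 * (a * c + 1) = - 2 * (- 1)"
  proof (rule sol3_integrability[OF f _ _ _ _ _ tt, of _ 2])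
    fix p
    show "partial 2 (partial 2 f) p
        = exp (2 * (- 1) * p $ 3) * (c - (- 1) * partial 3 f p) + a * (partial 2 f p)\<^sup>2"
      using eq[of p 2 2] by (simp add: eqs power2_eq_square algebra_simps)
    show "partial 3 (partial 2 f) p = (- 1) * partial 2 f p + a * partial 2 f p * partial 3 f p"
      using eq[of p 3 2] by (simp add: eqs algebra_simps)
    show "partial 2 (partial 3 f) p = (- 1) * partial 2 f p + a * partial 2 f p * partial 3 f p"
      using eq[of p 2 3] by (simp add: eqs algebra_simps)
  qed simp_all
  ultimately show False by simp
qed

end
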